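(* Let $\rho\ge0$ and $p_\rho:=(1+e^\rho)^{-1}$, so that $0<p_\rho\le\tfrac12$. Then, under the $\epsilon$-privacy leakage constraint $\rho^{(\epsilon\text{-}\mathsf P)}\le\rho$, the rate $$\mathsf R^{(\epsilon\text{-}\mathsf P)}_{\mathsf A}=\bigl(1-(1-p_\rho)^{\mathsf M-1}+1\bigr)^{-1}$$ is achievable by the $(\mathsf M,2)$ Scheme A with $S_1,\dots,S_{\mathsf M-1}$ i.i.d. $\mathrm{Bernoulli}(p_\rho)$; that is, this scheme has $\epsilon$-privacy leakage at most $\rho$ and rate $\mathsf R^{(\epsilon\text{-}\mathsf P)}_{\mathsf A}$.
   Context: Setting: $2$ noncolluding servers each store the same $\mathsf M$ independent files. Scheme A with $n=2$ has file length $\beta=1$ over $\{0,1\}$: each file is a uniform bit $X^{(m)}_1$, and $X^{(m)}_0:=0$. The requested index $M$ is uniform on $\{1,\dots,\mathsf M\}$, independent of the files. The user draws $S=(S_1,\dots,S_{\mathsf M-1})\in\{0,1\}^{\mathsf M-1}$ independently of $M$ and the files. If $M=m$ and $S=s$, the query to server $l\in\{1,2\}$ is $$q_l=(s_1,\dots,s_{m-1},q_{l,m},s_m,\dots,s_{\mathsf M-1}),\qquad q_{l,m}=\Bigl(l-1-\sum_{j=1}^{\mathsf M-1}s_j\Bigr)\bmod2,$$ so the query alphabet is $\mathcal Q_l=\{q\in\{0,1\}^{\mathsf M}:\sum_{m'}q_{m'}\equiv l-1 \pmod 2\}$. Server $l$ answers $A_l=X^{(1)}_{q_{l,1}}+\dots+X^{(\mathsf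 M)}_{q_{l,\mathsf M}}$ (mod 2); the answer length is $\ell_l(q_l)=0$ if $q_l=0$ and $1$ otherwise. $Q_l$ denotes the random query. Rate: $\mathsf R=\beta/\sum_l\mathbb E[\ell_l(Q_l)]$. The $\epsilon$-privacy leakage of the scheme is $$\rho^{(\epsilon\text{-}\mathsf P)}=\max_{l\in\{1,2\}}\ln\Bigl(\max_{q\in\mathcal Q_l}\max_{m,m'\in\{1,\dots,\mathsf M\}}\frac{P_{Q_l|M}(q|m)}{P_{Q_l|M}(q|m')}\Bigr).$$ *)

theory Defs
  imports "HOL-Probability.Probability"
begin

text \<open>
  Two servers \<open>l \<in> {1, 2}\<close>, \<open>M\<close> files, bits coded as the integers 0 and 1 (so that subtraction
  before reduction modulo 2 is exact). A vector indexed by \<open>{1..n}\<close> is a function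
  \<open>nat \<Rightarrow> int\<close> that is 0 outside \<open>{1..n}\<close>.
  An outcome \<open>(m, x, s)\<close> consists of the requested index \<open>m \<in> {1..M}\<close>, the files \<open>x\<close>
  (\<open>x i\<close> is the single bit of file \<open>i\<close>), and the user's key \<open>s = (s 1, \<dots>, s (M - 1))\<close>.
\<close>

type_synonym outcome = "nat \<times> (nat \<Rightarrow> int) \<times> (nat \<Rightarrow> int)"

definition bernoulli_bit :: "real \<Rightarrow> int pmf" where
  "bernoulli_bit p = map_pmf of_bool (bernoulli_pmf p)"

definition iid_bits :: "nat \<Rightarrow> real \<Rightarrow> (nat \<Rightarrow> int) pmf" where
  "iid_bits n p = Pi_pmf {1..n} 0 (\<lambda>_. bernoulli_bit p)"

text \<open>The key distribution \<open>D\<close> is a parameter; index, files and key are independent.\<close>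

definition schemeA :: "nat \<Rightarrow> (nat \<Rightarrow> int) pmf \<Rightarrow> outcome pmf" where
  "schemeA M D = pair_pmf (pmf_of_set {1..M}) (pair_pmf (iid_bits M (1/2)) D)"

definition query :: "nat \<Rightarrow> nat \<Rightarrow> nat \<Rightarrow> (nat \<Rightarrow> int) \<Rightarrow> (nat \<Rightarrow> int)" where
  "query M l m s = (\<lambda>i.
     if i \<notin> {1..M} then 0
     else if i < m then s i
     else if i = m then (int l - 1 - (\<Sum>j = 1..M - 1. s j)) mod 2
     else s (i - 1))"

definition rand_index :: "outcome \<Rightarrow> nat" where
  "rand_index = (\<lambda>(m, x, s). m)"

definition rand_query :: "nat \<Rightarrow> nat \<Rightarrow> outcome \<Rightarrow> (nat \<Rightarrow> int)" where
  "rand_query M l = (\<lambda>(m, x, s). query M l m s)"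

definition query_alphabet :: "nat \<Rightarrow> nat \<Rightarrow> (nat \<Rightarrow> int) set" where
  "query_alphabet M l =
     {q \<in> PiE_dflt {1..M} 0 (\<lambda>_. {0, 1}). (\<Sum>i = 1..M. q i) mod 2 = (int l - 1) mod 2}"

text \<open>The symbol at position 0 of a file is the fixed dummy 0, that at position 1 its bit.\<close>

definition file_symbol :: "(nat \<Rightarrow> int) \<Rightarrow> nat \<Rightarrow> int \<Rightarrow> int" where
  "file_symbol x i k = (if k = 0 then 0 else x i)"

definition answer :: "nat \<Rightarrow> (nat \<Rightarrow> int) \<Rightarrow> (nat \<Rightarrow> int) \<Rightarrow> int" where
  "answer M x q = (\<Sum>i = 1..M. file_symbol x i (q i)) mod 2"

definition answer_length :: "(nat \<Rightarrow> int) \<Rightarrow> nat" where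
  "answer_length q = (if q = (\<lambda>_. 0) then 0 else 1)"

definition file_length :: nat where
  "file_length = 1"

definition rate :: "nat \<Rightarrow> (nat \<Rightarrow> int) pmf \<Rightarrow> real" where
  "rate M D = real file_length /
     (\<Sum>l\<in>{1, 2}. measure_pmf.expectation (schemeA M D)
        (\<lambda>\<omega>. real (answer_length (rand_query M l \<omega>))))"

definition query_prob :: "nat \<Rightarrow> (nat \<Rightarrow> int) pmf \<Rightarrow> nat \<Rightarrow> (nat \<Rightarrow> int) \<Rightarrow> nat \<Rightarrow> real" where
  "query_prob M D l q m =
     \<P>(\<omega> in measure_pmf (schemeA M D). rand_query M l \<omega> = q \<bar> rand_index \<omega> = m)"

text \<open>
  The quotient is read in the reals, which is adequate when every query of the alphabet has positive
  probability given each index, in particular for i.i.d. key bits with parameter in \<open>{0<..<1}\<close>.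
\<close>

definition eps_leakage :: "nat \<Rightarrow> (nat \<Rightarrow> int) pmf \<Rightarrow> real" where
  "eps_leakage M D =
     (MAX l\<in>{1, 2}. ln (MAX q\<in>query_alphabet M l. MAX m\<in>{1..M}. MAX m'\<in>{1..M}.
        query_prob M D l q m / query_prob M D l q m'))"

definition p_of :: "real \<Rightarrow> real" where
  "p_of \<rho> = 1 / (1 + exp \<rho>)"

text \<open>Decodability: the two answers sum to the requested bit.\<close>

lemma answers_decode:
  assumes "m \<in> {1..M}" and x: "x m \<in> {0, 1}"
  shows "(answer M x (query M 1 m s) + answer M x (query M 2 m s)) mod 2 = x m"
proof -
  let ?a = "\<lambda>l i. file_symbol x i (query M l m s i)"
  have off: "?a 1 i + ?a 2 i = 2 * ?a 1 i" if "i \<in> {1..M} - {m}" for i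
    using that by (auto simp: query_def)
  have m: "?a 1 m + ?a 2 m = x m"
    using assms(1) by (auto simp: query_def file_symbol_def) presburger+
  have "(\<Sum>i = 1..M. ?a 1 i) + (\<Sum>i = 1..M. ?a 2 i) = (\<Sum>i = 1..M. ?a 1 i + ?a 2 i)"
    by (simp add: sum.distrib)
  also have "\<dots> = x m + (\<Sum>i\<in>{1..M} - {m}. ?a 1 i + ?a 2 i)"
    using assms(1) m by (simp add: sum.remove[of _ m])
  also have "\<dots> = x m + 2 * (\<Sum>i\<in>{1..M} - {m}. ?a 1 i)"
    unfolding sum_distrib_left by (simp only: off cong: sum.cong)
  finally have "((\<Sum>i = 1..M. ?a 1 i) + (\<Sum>i = 1..M. ?a 2 i)) mod 2 = x m mod 2"
    by simp
  then show ?thesis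
    using x by (auto simp: answer_def mod_simps)
qed

end

theory Submission
  imports Defs
begin

text \<open>
  Given the index \<open>m\<close>, a query \<open>q\<close> of the alphabet arises from exactly one key, namely \<open>q\<close> with its
  \<open>m\<close>-th entry deleted. Its conditional probability is therefore \<open>\<Prod>i\<noteq>m. b (q i)\<close>, where \<open>b\<close> is
  the Bernoulli mass function, and a quotient of two such products is \<open>b (q m') / b (q m)\<close>, at most
  \<open>(1 - p) / p = exp \<rho>\<close>. For the rate, the query to server 2 has odd weight and is never zero,
  whereas the query to server 1 is zero exactly when the key is zero.
\<close>

section \<open>Correspondence between keys and queries\<close>

definition delete_at :: "nat \<Rightarrow> nat \<Rightarrow> (nat \<Rightarrow> int) \<Rightarrow> (nat \<Rightarrow> int)" where
  "delete_at M m q = (\<lambda>i. if i \<notin> {1..M - 1} then 0 else if i < m then q i else q (i + 1))"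

text \<open>Renumbering of the key positions as the query positions other than \<open>m\<close>; it
  transports sums and products over a key to the query.\<close>

lemma bij_betw_skip:
  fixes m M :: nat
  assumes "m \<in> {1..M}"
  shows "bij_betw (\<lambda>i. if i < m then i else i + 1) {1..M - 1} ({1..M} - {m})"
  by (rule bij_betw_byWitness[where f' = "\<lambda>i. if i < m then i else i - 1"])
     (use assms in \<open>auto split: if_splits\<close>)

lemma sum_delete_at:
  assumes "m \<in> {1..M}"
  shows "(\<Sum>i = 1..M - 1. delete_at M m q i) = (\<Sum>i\<in>{1..M} - {m}. q i)"
  by (subst sum.reindex_bij_betw[OF bij_betw_skip[OF assms], symmetric])
     (auto simp: delete_at_def intro!: sum.cong)

lemma prod_delete_at:
  assumes "m \<in> {1..M}"
  shows "(\<Prod>i = 1..M - 1. f (delete_at M m q i)) = (\<Prod>i\<in>{1..M} - {m}. f (q i))"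
  by (subst prod.reindex_bij_betw[OF bij_betw_skip[OF assms], symmetric])
     (auto simp: delete_at_def intro!: prod.cong)

text \<open>A query reveals a key only at the positions \<open>{1..M - 1}\<close>. Fixing the
  default value 0 elsewhere lets the key be recovered as a function.\<close>

lemma query_eq_iff:
  assumes m: "m \<in> {1..M}" and q: "q \<in> query_alphabet M l"
    and s: "\<And>i. i \<notin> {1..M - 1} \<Longrightarrow> s i = 0"
  shows "query M l m s = q \<longleftrightarrow> s = delete_at M m q"
proof
  assume eq: "query M l m s = q"
  show "s = delete_at M m q"
    unfolding eq[symmetric] using m s by (auto simp: delete_at_def query_def fun_eq_iff)
next
  assume eq: "s = delete_at M m q"
  have q0: "q i = 0" if "i \<notin> {1..M}" for i
    using q that by (auto simp: query_alphabet_def PiE_dflt_def)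
  have "q m = 0 \<or> q m = 1" and "(\<Sum>i = 1..M. q i) mod 2 = (int l - 1) mod 2"
    using q m by (auto simp: query_alphabet_def PiE_dflt_def)
  \<comment> \<open>The parity condition of the alphabet determines the entry at \<open>m\<close>
    modulo 2 from the remaining entries; as that entry is 0 or 1, it equals its residue.\<close>
  moreover have "(\<Sum>i = 1..M. q i) = q m + (\<Sum>i = 1..M - 1. s i)"
    unfolding eq sum_delete_at[OF m] using m by (intro sum.remove) auto
  ultimately have "(int l - 1 - (\<Sum>i = 1..M - 1. s i)) mod 2 = q m"
    by presburger
  then show "query M l m s = q"
    using m q0 by (auto simp: query_def fun_eq_iff eq delete_at_def)
qed

section \<open>Distribution of the key and of the query given the index\<close>

lemma pmf_bernoulli_bit:
  assumes "0 \<le> p" "p \<le> 1"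
  shows "pmf (bernoulli_bit p) 0 = 1 - p" "pmf (bernoulli_bit p) 1 = p"
proof -
  have "inj (of_bool :: bool \<Rightarrow> int)"
    by (auto simp: inj_def)
  from pmf_map_inj'[OF this, of "bernoulli_pmf p" False] pmf_map_inj'[OF this, of "bernoulli_pmf p" True]
  show "pmf (bernoulli_bit p) 0 = 1 - p" "pmf (bernoulli_bit p) 1 = p"
    using assms by (simp_all add: bernoulli_bit_def)
qed

lemma iid_bits_support:
  assumes "s \<in> set_pmf (iid_bits n p)" "i \<notin> {1..n}"
  shows "s i = 0"
  using assms set_Pi_pmf_subset[of "{1..n}" 0 "\<lambda>_. bernoulli_bit p"]
  by (auto simp: iid_bits_def)

lemma pmf_iid_bits:
  assumes "\<And>i. i \<notin> {1..n} \<Longrightarrow> s i = 0"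
  shows "pmf (iid_bits n p) s = (\<Prod>i = 1..n. pmf (bernoulli_bit p) (s i))"
  unfolding iid_bits_def using assms by (subst pmf_Pi) auto

text \<open>Cutting both factors down to their countable supports gives the product rule for
  arbitrary sets, such as the uncountable \<open>UNIV\<close> of file vectors.\<close>

lemma measure_pair_pmf_Times:
  "measure_pmf.prob (pair_pmf P Q) (A \<times> B) = measure_pmf.prob P A * measure_pmf.prob Q B"
proof -
  have "measure_pmf.prob (pair_pmf P Q) (A \<times> B)
      = measure_pmf.prob (pair_pmf P Q) (A \<times> B \<inter> set_pmf (pair_pmf P Q))"
    by (rule measure_Int_set_pmf[symmetric])
  also have "A \<times> B \<inter> set_pmf (pair_pmf P Q) = (A \<inter> set_pmf P) \<times> (B \<inter> set_pmf Q)"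
    by auto
  also have "measure_pmf.prob (pair_pmf P Q) \<dots> = measure_pmf.prob P A * measure_pmf.prob Q B"
    by (subst measure_pmf_prob_product) (simp_all add: measure_Int_set_pmf)
  finally show ?thesis .
qed

lemma query_prob_eq_key_prob:
  assumes "m \<in> {1..M}"
  shows "query_prob M D l q m = measure_pmf.prob D {s. query M l m s = q}"
proof -
  let ?E = "{s. query M l m s = q}"
  have "{\<omega>. rand_query M l \<omega> = q \<and> rand_index \<omega> = m} = {m} \<times> UNIV \<times> ?E"
    by (auto simp: rand_query_def rand_index_def)
  moreover have "{\<omega> :: outcome. rand_index \<omega> = m} = {m} \<times> UNIV \<times> UNIV"
    by (auto simp: rand_index_def)
  \<comment> \<open>By independence, joint event and condition share the positive factor
    \<open>pmf (pmf_of_set {1..M}) m\<close>, which cancels in the conditional probability.\<close>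
  moreover have "measure_pmf.prob (schemeA M D) ({m} \<times> UNIV \<times> A)
      = pmf (pmf_of_set {1..M}) m * measure_pmf.prob D A" for A
    unfolding schemeA_def
    by (simp add: measure_pair_pmf_Times measure_pmf_single)
  ultimately show ?thesis
    using assms by (simp add: query_prob_def cond_prob_def del: UNIV_Times_UNIV)
qed

lemma query_prob_iid_bits:
  assumes m: "m \<in> {1..M}" and q: "q \<in> query_alphabet M l"
  shows "query_prob M (iid_bits (M - 1) p) l q m
    = (\<Prod>i\<in>{1..M} - {m}. pmf (bernoulli_bit p) (q i))"
proof -
  let ?D = "iid_bits (M - 1) p"
  \<comment> \<open>The two events may differ only on functions that are nonzero somewhere outside
    \<open>{1..M - 1}\<close>, which form a null set.\<close>
  have "measure_pmf.prob ?D {s. query M l m s = q} = measure_pmf.prob ?D {delete_at M m q}"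
    using query_eq_iff[OF m q] iid_bits_support[of _ "M - 1" p]
    by (intro measure_eq_AE) (auto simp: AE_measure_pmf_iff)
  also have "\<dots> = (\<Prod>i = 1..M - 1. pmf (bernoulli_bit p) (delete_at M m q i))"
    unfolding measure_pmf_single by (rule pmf_iid_bits) (simp add: delete_at_def)
  finally show ?thesis
    unfolding query_prob_eq_key_prob[OF m] prod_delete_at[OF m] .
qed

section \<open>Bound on the leakage\<close>

lemma finite_query_alphabet: "finite (query_alphabet M l)"
  unfolding query_alphabet_def
  by (rule finite_subset[OF _ finite_PiE_dflt[of "{1..M}" "\<lambda>_. {0, 1}" 0]]) auto

lemma query_alphabet_nonempty:
  assumes "M \<ge> 1" "l \<in> {1, 2}"
  shows "query_alphabet M l \<noteq> {}"
proof -
  \<comment> \<open>The single entry \<open>int l - 1\<close> is 0 or 1 and is also the sum of the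
    vector, so the parity is right.\<close>
  have "(\<lambda>i. if i = 1 then int l - 1 else 0) \<in> query_alphabet M l"
    using assms by (auto simp: query_alphabet_def PiE_dflt_def sum.delta)
  then show ?thesis by blast
qed

lemma query_prob_ratio:
  assumes p: "0 < p" "p \<le> 1 / 2" and q: "q \<in> query_alphabet M l"
    and m: "m \<in> {1..M}" "m' \<in> {1..M}"
  defines "r \<equiv> query_prob M (iid_bits (M - 1) p) l q m / query_prob M (iid_bits (M - 1) p) l q m'"
  shows "0 < r" "r \<le> (1 - p) / p"
proof -
  let ?b = "\<lambda>i. pmf (bernoulli_bit p) (q i)"
  \<comment> \<open>Since \<open>p \<le> 1 / 2\<close>, the smaller of the two masses
    \<open>p\<close> and \<open>1 - p\<close> is \<open>p\<close>.\<close>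
  have b: "p \<le> ?b i" "?b i \<le> 1 - p" if "i \<in> {1..M}" for i
  proof -
    have "q i \<in> {0, 1}"
      using q that by (auto simp: query_alphabet_def PiE_dflt_def)
    then show "p \<le> ?b i" "?b i \<le> 1 - p"
      using p by (auto simp: pmf_bernoulli_bit)
  qed
  then have pos: "?b i > 0" if "i \<in> {1..M}" for i
    using that p by force
  \<comment> \<open>The product over all positions does not depend on the index; it cancels in the
    quotient and leaves one factor from each side.\<close>
  let ?W = "\<Prod>i = 1..M. ?b i"
  have W: "?W > 0"
    using pos by (intro prod_pos) auto
  have prob: "query_prob M (iid_bits (M - 1) p) l q k = ?W / ?b k" if "k \<in> {1..M}" for k
    unfolding query_prob_iid_bits[OF that q] using that pos[OF that]
    by (simp add: prod.remove[of "{1..M}" k] del: One_nat_def)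
  have r: "r = ?b m' / ?b m"
    unfolding r_def prob[OF m(1)] prob[OF m(2)] using W by (simp del: prod_zero_iff)
  show "0 < r"
    using pos m by (simp add: r)
  show "r \<le> (1 - p) / p"
    unfolding r using b m p by (intro frac_le) auto
qed

text \<open>The maximum is attained. With an arbitrary set \<open>I\<close>, positivity (needed for
  monotonicity of \<open>ln\<close>) and the upper bound pass through the nested maxima
  together.\<close>

lemma Max_image_in:
  assumes "finite A" "A \<noteq> {}" "\<And>x. x \<in> A \<Longrightarrow> f x \<in> I"
  shows "(MAX x\<in>A. f x) \<in> I"
proof -
  have "(MAX x\<in>A. f x) \<in> f ` A"
    using assms(1,2) by (intro Max_in) auto
  then show ?thesis
    using assms(3) by auto
qed

lemma eps_leakage_le:
  assumes M: "M \<ge> 1" and p: "0 < p" "p \<le> 1 / 2"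
  shows "eps_leakage M (iid_bits (M - 1) p) \<le> ln ((1 - p) / p)"
proof -
  let ?P = "query_prob M (iid_bits (M - 1) p)"
  have "ln (MAX q\<in>query_alphabet M l. MAX m\<in>{1..M}. MAX m'\<in>{1..M}. ?P l q m / ?P l q m')
      \<le> ln ((1 - p) / p)" if l: "l \<in> {1, 2}" for l
  proof -
    have "(MAX q\<in>query_alphabet M l. MAX m\<in>{1..M}. MAX m'\<in>{1..M}. ?P l q m / ?P l q m')
        \<in> {0<..(1 - p) / p}"
    proof (intro Max_image_in finite_query_alphabet query_alphabet_nonempty[OF M l])
      fix q m m'
      assume "q \<in> query_alphabet M l" "m \<in> {1..M}" "m' \<in> {1..M}"
      from query_prob_ratio[OF p this] show "?P l q m / ?P l q m' \<in> {0<..(1 - p) / p}"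
        by simp
    qed (use M in auto)
    then show ?thesis by simp
  qed
  then show ?thesis
    unfolding eps_leakage_def by (subst Max_le_iff) auto
qed

section \<open>Expected answer lengths and the rate\<close>

lemma query_1_eq_0_iff:
  assumes m: "m \<in> {1..M}" and s: "\<And>i. i \<notin> {1..M - 1} \<Longrightarrow> s i = 0"
  shows "query M 1 m s = (\<lambda>_. 0) \<longleftrightarrow> s = (\<lambda>_. 0)"
proof -
  have "(\<lambda>_. 0) \<in> query_alphabet M 1"
    by (auto simp: query_alphabet_def PiE_dflt_def)
  moreover have "delete_at M m (\<lambda>_. 0) = (\<lambda>_. 0)"
    by (auto simp: delete_at_def)
  ultimately show ?thesis
    using query_eq_iff[OF m _ s] by simp
qed

lemma query_2_neq_0:
  assumes m: "m \<in> {1..M}" and s: "\<And>i. i \<notin> {1..M - 1} \<Longrightarrow> s i = 0"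
  shows "query M 2 m s \<noteq> (\<lambda>_. 0)"
proof
  assume eq: "query M 2 m s = (\<lambda>_. 0)"
  \<comment> \<open>Key entry \<open>i\<close> appears in the query at position \<open>i\<close> if
    \<open>i < m\<close> and at \<open>i + 1\<close> otherwise, so a zero query forces a zero key.
    The entry at \<open>m\<close> would then be \<open>(2 - 1) mod 2 = 1\<close>.\<close>
  have "s i = 0" if i: "i \<in> {1..M - 1}" for i
    using fun_cong[OF eq, of i] fun_cong[OF eq, of "i + 1"] i
    by (cases "i < m") (auto simp: query_def split: if_splits)
  then have "query M 2 m s m = 1"
    using m by (simp add: query_def)
  then show False
    by (simp add: eq)
qed

lemma
  fixes M :: nat and p :: real
  assumes M: "M \<ge> 1" and p: "0 \<le> p" "p \<le> 1"
  defines "D \<equiv> iid_bits (M - 1) p"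
  shows expected_length_1: "measure_pmf.expectation (schemeA M D)
      (\<lambda>\<omega>. real (answer_length (rand_query M 1 \<omega>))) = 1 - (1 - p) ^ (M - 1)"
    and expected_length_2: "measure_pmf.expectation (schemeA M D)
      (\<lambda>\<omega>. real (answer_length (rand_query M 2 \<omega>))) = 1"
proof -
  have supp: "m \<in> {1..M}" "\<And>i. i \<notin> {1..M - 1} \<Longrightarrow> s i = 0"
    if "(m, x, s) \<in> set_pmf (schemeA M D)" for m x s
    using that M iid_bits_support[of s "M - 1" p] by (auto simp: schemeA_def D_def)
  have "map_pmf snd (map_pmf snd (schemeA M D)) = D"
    unfolding schemeA_def map_snd_pair_pmf ..
  then have key: "map_pmf (\<lambda>\<omega>. snd (snd \<omega>)) (schemeA M D) = D"
    by (simp add: pmf.map_comp o_def)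
  \<comment> \<open>Almost surely the length is 1 minus the indicator of the zero key, so only the
    law of the key matters.\<close>
  have "measure_pmf.expectation (schemeA M D) (\<lambda>\<omega>. real (answer_length (rand_query M 1 \<omega>)))
      = measure_pmf.expectation (schemeA M D) (\<lambda>\<omega>. 1 - indicator {\<lambda>_. 0} (snd (snd \<omega>)))"
    using supp query_1_eq_0_iff
    by (intro integral_cong_AE) (auto simp: AE_measure_pmf_iff rand_query_def answer_length_def
        indicator_def)
  also have "\<dots> = measure_pmf.expectation D (\<lambda>s. 1 - indicator {\<lambda>_. 0} s)"
    by (subst key[symmetric]) simp
  also have "\<dots> = 1 - pmf D (\<lambda>_. 0)"
    by (subst Bochner_Integration.integral_diff)
      (auto simp: measure_pmf_single intro!: measure_pmf.integrable_const_bound[where B = 1])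
  also have "pmf D (\<lambda>_. 0) = (1 - p) ^ (M - 1)"
    using p by (simp add: D_def pmf_iid_bits pmf_bernoulli_bit)
  finally show "measure_pmf.expectation (schemeA M D)
      (\<lambda>\<omega>. real (answer_length (rand_query M 1 \<omega>))) = 1 - (1 - p) ^ (M - 1)" .
  have "measure_pmf.expectation (schemeA M D) (\<lambda>\<omega>. real (answer_length (rand_query M 2 \<omega>)))
      = measure_pmf.expectation (schemeA M D) (\<lambda>_. 1)"
    using supp query_2_neq_0
    by (intro integral_cong_AE) (auto simp: AE_measure_pmf_iff rand_query_def answer_length_def)
  then show "measure_pmf.expectation (schemeA M D)
      (\<lambda>\<omega>. real (answer_length (rand_query M 2 \<omega>))) = 1"
    by simp
qed

theorem theorem7:
  fixes M :: nat and \<rho> :: real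
  assumes "M \<ge> 1" and "\<rho> \<ge> 0"
  shows "0 < p_of \<rho> \<and> p_of \<rho> \<le> 1 / 2
    \<and> eps_leakage M (iid_bits (M - 1) (p_of \<rho>)) \<le> \<rho>
    \<and> rate M (iid_bits (M - 1) (p_of \<rho>)) = inverse (1 - (1 - p_of \<rho>) ^ (M - 1) + 1)"
proof -
  have e: "exp \<rho> \<ge> 1"
    using assms(2) by simp
  then have e': "1 + exp \<rho> > 0"
    by linarith
  have p: "0 < p_of \<rho>" "p_of \<rho> \<le> 1 / 2"
    using e e' by (simp_all add: p_of_def divide_le_eq)
  \<comment> \<open>\<open>p_of\<close> is calibrated so that the largest possible likelihood ratio
    is exactly \<open>exp \<rho>\<close>.\<close>
  have "(1 - p_of \<rho>) / p_of \<rho> = exp \<rho>"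
    using e e' by (simp add: p_of_def field_simps)
  then have "eps_leakage M (iid_bits (M - 1) (p_of \<rho>)) \<le> \<rho>"
    using eps_leakage_le[OF assms(1) p] by simp
  moreover have "rate M (iid_bits (M - 1) (p_of \<rho>)) = inverse (1 - (1 - p_of \<rho>) ^ (M - 1) + 1)"
    using p expected_length_1[OF assms(1), of "p_of \<rho>"] expected_length_2[OF assms(1), of "p_of \<rho>"]
    by (simp add: rate_def file_length_def inverse_eq_divide)
  ultimately show ?thesis
    using p by blast
qed

end
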